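(* Let $b>-\frac{3}{16}$, and let $(\omega_0,c_0)\in\mathbb{R}^2$ satisfy $\omega_0>0$ and $c_0=2\sqrt{\omega_0}$. Let $\Omega=\{(\omega,c)\in\mathbb{R}^2 : -2\sqrt{\omega}<c<2\sqrt{\omega}\}$. Then for every integer $m\geq 0$, $$\lim_{\substack{(\omega,c)\to(\omega_0,c_0)\\ (\omega,c)\in\Omega}}\|\phi_{\omega,c}-\phi_{\omega_0,c_0}\|_{H^m(\mathbb{R})}=0,$$ where $\phi_{\omega,c}$ are the soliton profiles defined in the context.
   Context: Let $b>-\frac{3}{16}$ and $\gamma:=1+\frac{16}{3}b>0$. For $\omega>0$ and $-2\sqrt{\omega}<c\leq 2\sqrt{\omega}$ let $\Phi_{\omega,c}:\mathbb{R}\to(0,\infty)$ be the positive function given by $$\Phi_{\omega,c}^2(x)=\begin{cases}\dfrac{2(4\omega-c^2)}{\sqrt{c^2+\gamma(4\omega-c^2)}\,\cosh(\sqrt{4\omega-c^2}\,x)-c} & \text{if } -2\sqrt{\omega}<c<2\sqrt{\omega},\\[3mm] \dfrac{4c}{(cx)^2+\gamma} & \text{if } c=2\sqrt{\omega},\end{cases}$$ and define the complex-valued profile $$\phi_{\omega,c}(x)=\Phi_{\omega,c}(x)\exp\left(\frac{i}{2}cx-\frac{i}{4}\int_{-\infty}^{x}|\Phi_{\omega,c}(y)|^2\,dy\right).$$ (Then $e^{i\omega t}\phi_{\omega,c}(x-ct)$ is a solution of $i\partial_t u+\partial_x^2u+i|u|^2\partial_xu+b|u|^4u=0$ on $\mathbb{R}\times\mathbb{R}$.)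 $H^m(\mathbb{R})$ is the usual Sobolev space of complex-valued functions, with $H^0=L^2$. *)

theory Defs
  imports "HOL-Analysis.Analysis"
begin

subsection \<open>The Sobolev spaces \<open>H\<^sup>m\<close> of complex-valued functions on the real line\<close>

definition test_function :: "(real \<Rightarrow> real) \<Rightarrow> bool" where
  "test_function \<psi> \<longleftrightarrow>
     (\<forall>k x. (deriv ^^ k) \<psi> field_differentiable (at x)) \<and> compact (closure {x. \<psi> x \<noteq> 0})"

definition locally_integrable :: "(real \<Rightarrow> complex) \<Rightarrow> bool" where
  "locally_integrable f \<longleftrightarrow> (\<forall>K. compact K \<longrightarrow> set_integrable lebesgue K f)"

definition has_weak_derivative :: "nat \<Rightarrow> (real \<Rightarrow> complex) \<Rightarrow> (real \<Rightarrow> complex) \<Rightarrow> bool" where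
  "has_weak_derivative k f g \<longleftrightarrow>
     locally_integrable f \<and> locally_integrable g \<and>
     (\<forall>\<psi>. test_function \<psi> \<longrightarrow>
        (LINT x|lebesgue. (deriv ^^ k) \<psi> x *\<^sub>R f x) = (- 1) ^ k * (LINT x|lebesgue. \<psi> x *\<^sub>R g x))"

definition square_integrable :: "(real \<Rightarrow> complex) \<Rightarrow> bool" where
  "square_integrable f \<longleftrightarrow>
     f \<in> borel_measurable lebesgue \<and> integrable lebesgue (\<lambda>x. (norm (f x))\<^sup>2)"

text \<open>
  A weak derivative is determined only up to a null set, so \<open>weak_derivatives m f\<close> collects all
  choices of representatives \<open>(g 0, \<dots>, g m)\<close> of the weak derivatives of \<open>f\<close> of orders \<open>0, \<dots>, m\<close>
  lying in \<open>L\<^sup>2\<close>.  It is nonempty iff \<open>f\<close> belongs to \<open>H\<^sup>m\<close>.  In that case the integrals below do not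
  depend on the choice of \<open>g\<close>, so the infimum is over a singleton; it serves to give the norm the
  value \<open>\<infinity>\<close> when \<open>f\<close> is not in \<open>H\<^sup>m\<close>.
\<close>

definition weak_derivatives :: "nat \<Rightarrow> (real \<Rightarrow> complex) \<Rightarrow> (nat \<Rightarrow> real \<Rightarrow> complex) set" where
  "weak_derivatives m f = {g. \<forall>k\<le>m. has_weak_derivative k f (g k) \<and> square_integrable (g k)}"

definition sobolev_norm :: "nat \<Rightarrow> (real \<Rightarrow> complex) \<Rightarrow> ennreal" where
  "sobolev_norm m f =
     (INF g\<in>weak_derivatives m f. ennreal (sqrt (\<Sum>k\<le>m. LINT x|lebesgue. (norm (g k x))\<^sup>2)))"


subsection \<open>The soliton profiles\<close>

definition gam :: "real \<Rightarrow> real" where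
  "gam b = 1 + 16 / 3 * b"

text \<open>Only meaningful for \<open>\<omega> > 0\<close> and \<open>- 2 * sqrt \<omega> < c \<le> 2 * sqrt \<omega>\<close>.\<close>

definition \<Phi> :: "real \<Rightarrow> real \<Rightarrow> real \<Rightarrow> real \<Rightarrow> real" where
  "\<Phi> b \<omega> c x = sqrt
     (if c = 2 * sqrt \<omega> then 4 * c / ((c * x)\<^sup>2 + gam b)
      else 2 * (4 * \<omega> - c\<^sup>2) /
        (sqrt (c\<^sup>2 + gam b * (4 * \<omega> - c\<^sup>2)) * cosh (sqrt (4 * \<omega> - c\<^sup>2) * x) - c))"

definition \<phi> :: "real \<Rightarrow> real \<Rightarrow> real \<Rightarrow> real \<Rightarrow> complex" where
  "\<phi> b \<omega> c x = complex_of_real (\<Phi> b \<omega> c x) *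
     exp (\<i> / 2 * complex_of_real (c * x)
          - \<i> / 4 * complex_of_real (LINT y:{..x}|lebesgue. \<bar>\<Phi> b \<omega> c y\<bar>\<^sup>2))"

definition \<Omega> :: "(real \<times> real) set" where
  "\<Omega> = {(\<omega>, c). 0 < \<omega> \<and> - 2 * sqrt \<omega> < c \<and> c < 2 * sqrt \<omega>}"

end

theory Submission
  imports Defs "HOL-Probability.Sinc_Integral"
begin

text \<open>
  Put \<open>s\<^sup>2 = 4 \<omega> - c\<^sup>2\<close>.  The functions \<open>F = \<Phi>\<^sup>2\<close> and \<open>h = \<Phi>' / \<Phi>\<close> satisfy
  \<open>F' = 2 h F\<close> and \<open>h' = 2 h\<^sup>2 - s\<^sup>2 / 2 - c F / 4\<close>, with \<open>s = 0\<close> for the algebraic soliton, and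
  \<open>\<phi>' = \<phi> (h + i c / 2 - i F / 4)\<close>.  Hence the \<open>k\<close>-th derivative of \<open>\<phi>\<close> is \<open>\<phi>\<close> times a fixed
  polynomial in \<open>h, F, c, s\<^sup>2\<close>.  As \<open>s \<rightarrow> 0\<close>, all of these converge pointwise, the phase included.
  Moreover \<open>F \<le> K / (1 + x\<^sup>2)\<close> uniformly near the limit, and \<open>h\<close> stays bounded since
  \<open>h\<^sup>2 \<le> s\<^sup>2 / 4 + c F / 4\<close>.  So the squared moduli of all derivatives are dominated by a
  multiple of \<open>1 / (1 + x\<^sup>2)\<close>, and dominated convergence gives convergence in every \<open>H\<^sup>m\<close>.
\<close>

subsection \<open>Classical derivatives are weak derivatives\<close>

text \<open>Off the closed support, \<open>\<psi>\<close> is zero on a whole neighbourhood, so its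
  derivative vanishes there too and the support cannot grow.\<close>

lemma test_function_deriv:
  assumes "test_function \<psi>"
  shows "test_function (deriv \<psi>)"
proof -
  let ?S = "closure {x. \<psi> x \<noteq> 0}"
  have "deriv \<psi> x = 0" if "x \<notin> ?S" for x
  proof -
    have "(\<psi> has_field_derivative 0) (at x)"
    proof (rule DERIV_cong_ev[THEN iffD2])
      show "eventually (\<lambda>y. \<psi> y = 0) (nhds x)"
        using that closure_subset[of "{x. \<psi> x \<noteq> 0}"]
        by (intro eventually_nhds[THEN iffD2] exI[of _ "- ?S"]) auto
    qed (auto intro!: derivative_eq_intros)
    then show ?thesis by (rule DERIV_imp_deriv)
  qed
  then have "closure {x. deriv \<psi> x \<noteq> 0} \<subseteq> ?S"
    by (intro closure_minimal) auto
  moreover have "compact ?S"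
    using assms by (simp add: test_function_def)
  ultimately have "compact (closure {x. deriv \<psi> x \<noteq> 0})"
    by (metis closed_closure compact_Int_closed inf.absorb2)
  moreover have "(deriv ^^ k) (deriv \<psi>) field_differentiable (at x)" for k x
    using assms unfolding test_function_def
    by (metis comp_apply funpow_Suc_right)
  ultimately show ?thesis by (simp add: test_function_def)
qed

lemma test_function_support:
  assumes "test_function \<psi>"
  obtains M where "M > 0" "\<And>x. M \<le> \<bar>x\<bar> \<Longrightarrow> \<psi> x = 0"
proof -
  have "bounded (closure {x. \<psi> x \<noteq> 0})"
    using assms by (simp add: test_function_def compact_imp_bounded)
  then obtain M where M: "M > 0" "\<And>x. x \<in> closure {x. \<psi> x \<noteq> 0} \<Longrightarrow> norm x \<le> M"
    by (auto simp: bounded_pos)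
  have *: "\<bar>x\<bar> \<le> M" if "\<psi> x \<noteq> 0" for x
    using M(2)[of x] that closure_subset[of "{x. \<psi> x \<noteq> 0}"] by auto
  show ?thesis
    \<comment> \<open>The support only gives \<open>\<bar>x\<bar> \<le> M\<close>; enlarging to
      \<open>M + 1\<close> makes \<open>\<psi>\<close> vanish at the end points as well.\<close>
    by (rule that[of "M + 1"]) (use M(1) * in force)+
qed

lemma test_function_DERIV:
  assumes "test_function \<psi>"
  shows "(\<psi> has_real_derivative deriv \<psi> x) (at x)"
proof -
  have "(deriv ^^ 0) \<psi> field_differentiable (at x)"
    using assms unfolding test_function_def by blast
  then show ?thesis
    by (simp add: field_differentiable_derivI)
qed

lemma test_function_continuous:
  assumes "test_function \<psi>"
  shows "continuous_on UNIV \<psi>"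
  using test_function_DERIV[OF assms] DERIV_continuous
  by (metis continuous_at_imp_continuous_on)

lemma has_vector_derivative_imp_continuous_on:
  assumes "\<And>x. (f has_vector_derivative f' x) (at x)"
  shows "continuous_on A f"
  using assms by (intro continuous_at_imp_continuous_on ballI has_vector_derivative_continuous)

text \<open>Passes from the Lebesgue integral to a gauge integral over an interval, where the
  fundamental theorem of calculus is available.\<close>

lemma integral_compactly_supported:
  fixes f :: "real \<Rightarrow> 'a :: euclidean_space"
  assumes "continuous_on UNIV f" and "\<And>x. x \<notin> {a..b} \<Longrightarrow> f x = 0"
  shows "integral\<^sup>L lebesgue f = integral {a..b} f"
proof -
  have *: "set_integrable lebesgue {a..b} f"
    using assms(1) by (intro absolutely_integrable_continuous_real) (rule continuous_on_subset, auto)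
  have eq: "(\<lambda>x. indicator {a..b} x *\<^sub>R f x) = f"
    using assms(2) by (auto simp: indicator_def)
  show "integral\<^sup>L lebesgue f = integral {a..b} f"
    using set_lebesgue_integral_eq_integral(2)[OF *] unfolding set_lebesgue_integral_def eq .
qed

lemma test_function_integration_by_parts:
  fixes f f' :: "real \<Rightarrow> complex"
  assumes \<psi>: "test_function \<psi>"
    and f: "\<And>x. (f has_vector_derivative f' x) (at x)" and f': "continuous_on UNIV f'"
  shows "(LINT x|lebesgue. deriv \<psi> x *\<^sub>R f x) = - (LINT x|lebesgue. \<psi> x *\<^sub>R f' x)"
proof -
  obtain M where M: "M > 0" "\<And>x. M \<le> \<bar>x\<bar> \<Longrightarrow> \<psi> x = 0"
    using test_function_support[OF \<psi>] by blast
  obtain M' where M': "M' > 0" "\<And>x. M' \<le> \<bar>x\<bar> \<Longrightarrow> deriv \<psi> x = 0"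
    using test_function_support[OF test_function_deriv[OF \<psi>]] by blast
  define r where "r = max M M'"
  have r: "r > 0" "\<And>x. r \<le> \<bar>x\<bar> \<Longrightarrow> \<psi> x = 0" "\<And>x. r \<le> \<bar>x\<bar> \<Longrightarrow> deriv \<psi> x = 0"
    using M M' by (auto simp: r_def)
  have f_cont: "continuous_on UNIV f"
    using f by (rule has_vector_derivative_imp_continuous_on)
  note cont = test_function_continuous[OF \<psi>] test_function_continuous[OF test_function_deriv[OF \<psi>]]
  have c1: "continuous_on UNIV (\<lambda>x. deriv \<psi> x *\<^sub>R f x)" and c2: "continuous_on UNIV (\<lambda>x. \<psi> x *\<^sub>R f' x)"
    by (intro continuous_intros cont f_cont f')+
  have z: "deriv \<psi> x *\<^sub>R f x = 0" "\<psi> x *\<^sub>R f' x = 0" if "x \<notin> {-r..r}" for x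
    using r(2)[of x] r(3)[of x] that by auto
  have i1: "(LINT x|lebesgue. deriv \<psi> x *\<^sub>R f x) = integral {-r..r} (\<lambda>x. deriv \<psi> x *\<^sub>R f x)"
    using c1 z(1) by (rule integral_compactly_supported)
  have i2: "(LINT x|lebesgue. \<psi> x *\<^sub>R f' x) = integral {-r..r} (\<lambda>x. \<psi> x *\<^sub>R f' x)"
    using c2 z(2) by (rule integral_compactly_supported)
  \<comment> \<open>The boundary terms vanish because \<open>\<psi>\<close> is zero at both end
    points of the interval.\<close>
  have "((\<lambda>x. \<psi> x *\<^sub>R f' x + deriv \<psi> x *\<^sub>R f x) has_integral \<psi> r *\<^sub>R f r - \<psi> (-r) *\<^sub>R f (-r)) {-r..r}"
    using r(1) test_function_DERIV[OF \<psi>] f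
    by (intro fundamental_theorem_of_calculus)
       (auto intro!: has_vector_derivative_scaleR intro: has_vector_derivative_at_within DERIV_subset)
  then have "integral {-r..r} (\<lambda>x. \<psi> x *\<^sub>R f' x + deriv \<psi> x *\<^sub>R f x) = 0"
    using r by (simp add: integral_unique)
  moreover have "integral {-r..r} (\<lambda>x. \<psi> x *\<^sub>R f' x + deriv \<psi> x *\<^sub>R f x) =
      integral {-r..r} (\<lambda>x. \<psi> x *\<^sub>R f' x) + integral {-r..r} (\<lambda>x. deriv \<psi> x *\<^sub>R f x)"
    by (intro Henstock_Kurzweil_Integration.integral_add integrable_continuous_real continuous_on_subset[OF c1]
        continuous_on_subset[OF c2]) auto
  ultimately show ?thesis
    unfolding i1 i2 by (simp add: add_eq_0_iff)
qed

lemma has_weak_derivative_of_classical: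
  assumes f: "\<And>k x. (f k has_vector_derivative f (Suc k) x) (at x)"
  shows "has_weak_derivative k (f 0) (f k)"
proof -
  have cont: "continuous_on UNIV (f k)" for k
    using f by (rule has_vector_derivative_imp_continuous_on)
  have loc: "locally_integrable (f k)" for k
    unfolding locally_integrable_def
  proof (intro allI impI)
    fix K :: "real set" assume K: "compact K"
    then obtain a b where ab: "K \<subseteq> {a..b}"
      by (metis bounded_subset_cbox_symmetric compact_imp_bounded box_real(2))
    have "set_integrable lebesgue {a..b} (f k)"
      by (intro absolutely_integrable_continuous_real continuous_on_subset[OF cont]) auto
    then show "set_integrable lebesgue K (f k)"
      by (rule set_integrable_subset) (use ab K in \<open>auto simp: borel_compact\<close>)
  qed
  \<comment> \<open>The induction keeps \<open>\<psi>\<close> arbitrary, since its hypothesis is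
    applied to \<open>deriv \<psi>\<close>; the one derivative left over is then moved by
    integration by parts.\<close>
  have "(LINT x|lebesgue. (deriv ^^ k) \<psi> x *\<^sub>R f j x) = (- 1) ^ k * (LINT x|lebesgue. \<psi> x *\<^sub>R f (j + k) x)"
    if "test_function \<psi>" for \<psi> j
    using that
  proof (induction k arbitrary: \<psi> j)
    case (Suc k)
    have "(LINT x|lebesgue. (deriv ^^ Suc k) \<psi> x *\<^sub>R f j x) =
        (LINT x|lebesgue. (deriv ^^ k) (deriv \<psi>) x *\<^sub>R f j x)"
      by (simp only: funpow_Suc_right o_apply)
    also have "\<dots> = (- 1) ^ k * (LINT x|lebesgue. deriv \<psi> x *\<^sub>R f (j + k) x)"
      by (intro Suc.IH test_function_deriv Suc.prems)
    also have "(LINT x|lebesgue. deriv \<psi> x *\<^sub>R f (j + k) x) =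
        - (LINT x|lebesgue. \<psi> x *\<^sub>R f (Suc (j + k)) x)"
      by (intro test_function_integration_by_parts Suc.prems f cont)
    finally show ?case by simp
  qed simp
  from this[of _ 0] show ?thesis
    by (simp add: has_weak_derivative_def loc)
qed

section \<open>A dominated convergence criterion for the Sobolev norm\<close>

lemma continuous_borel_measurable_lebesgue:
  fixes f :: "real \<Rightarrow> 'a :: topological_space"
  assumes "continuous_on UNIV f"
  shows "f \<in> borel_measurable lebesgue"
  using borel_measurable_continuous_onI[OF assms]
  by (intro measurable_completion) simp

lemma integrable_inverse_1_plus_square_lebesgue:
  "integrable lebesgue (\<lambda>x::real. C / (1 + x\<^sup>2))"
proof -
  have "integrable lborel (\<lambda>x::real. inverse (1 + x\<^sup>2))"
    using integrable_inverse_1_plus_square by (simp add: set_integrable_def)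
  then have "integrable lebesgue (\<lambda>x::real. inverse (1 + x\<^sup>2))"
    by (subst integrable_completion) auto
  then have "integrable lebesgue (\<lambda>x::real. C * inverse (1 + x\<^sup>2))"
    by (rule integrable_mult_right)
  then show ?thesis by (simp add: divide_inverse)
qed

text \<open>The norm is an infimum, so the choice of the classical derivatives as representatives
  bounds it from above. Each of the finitely many integrals in that bound tends to 0 by dominated
  convergence.\<close>

lemma sobolev_norm_tendsto_0:
  fixes f :: "nat \<Rightarrow> nat \<Rightarrow> real \<Rightarrow> complex"
  assumes deriv: "\<And>n k x. (f n k has_vector_derivative f n (Suc k) x) (at x)"
    and lim: "\<And>k x. (\<lambda>n. f n k x) \<longlonglongrightarrow> 0"
    and bound: "\<And>n k x. (norm (f n k x))\<^sup>2 \<le> C k / (1 + x\<^sup>2)"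
  shows "(\<lambda>n. sobolev_norm m (f n 0)) \<longlonglongrightarrow> 0"
proof -
  have meas: "f n k \<in> borel_measurable lebesgue" for n k
    by (rule continuous_borel_measurable_lebesgue)
       (rule has_vector_derivative_imp_continuous_on, rule deriv)
  have int: "integrable lebesgue (\<lambda>x. (norm (f n k x))\<^sup>2)" for n k
  proof (rule Bochner_Integration.integrable_bound[OF integrable_inverse_1_plus_square_lebesgue[of "C k"]])
    show "AE x in lebesgue. norm ((norm (f n k x))\<^sup>2) \<le> norm (C k / (1 + x\<^sup>2))"
      using bound[of n k] by (intro AE_I2) (simp, meson abs_ge_self divide_right_mono order_trans add_nonneg_nonneg zero_le_one zero_le_power2)
  qed (use meas in auto)
  have le: "sobolev_norm m (f n 0) \<le> ennreal (sqrt (\<Sum>k\<le>m. LINT x|lebesgue. (norm (f n k x))\<^sup>2))" for n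
    unfolding sobolev_norm_def
  proof (rule INF_lower)
    have "has_weak_derivative k (f n 0) (f n k)" for k
      using has_weak_derivative_of_classical[of "f n"] deriv by blast
    then show "f n \<in> weak_derivatives m (f n 0)"
      by (simp add: weak_derivatives_def square_integrable_def meas int)
  qed
  have "(\<lambda>n. LINT x|lebesgue. (norm (f n k x))\<^sup>2) \<longlonglongrightarrow> (LINT x::real|lebesgue. 0)" for k
  proof (rule integral_dominated_convergence)
    show "AE x in lebesgue. (\<lambda>n. (norm (f n k x))\<^sup>2) \<longlonglongrightarrow> 0"
      using tendsto_power[OF tendsto_norm[OF lim], of k _ 2] by (auto intro!: AE_I2)
  qed (use meas bound integrable_inverse_1_plus_square_lebesgue[of "C k"] in auto)
  then have "(\<lambda>n. \<Sum>k\<le>m. LINT x|lebesgue. (norm (f n k x))\<^sup>2) \<longlonglongrightarrow> 0"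
    by (intro tendsto_null_sum) simp
  then have "(\<lambda>n. ennreal (sqrt (\<Sum>k\<le>m. LINT x|lebesgue. (norm (f n k x))\<^sup>2))) \<longlonglongrightarrow> ennreal (sqrt 0)"
    by (intro tendsto_ennrealI tendsto_real_sqrt)
  then have lim0: "(\<lambda>n. ennreal (sqrt (\<Sum>k\<le>m. LINT x|lebesgue. (norm (f n k x))\<^sup>2))) \<longlonglongrightarrow> 0"
    by simp
  show ?thesis
    by (rule tendsto_sandwich[OF _ _ tendsto_const lim0]) (use le in auto)
qed

subsection \<open>The squared profile\<close>

text \<open>The extension to \<open>s = 0\<close> puts the exponentially decaying solitons (\<open>s > 0\<close>) and the algebraic one
  (\<open>s = 0\<close>) into a single family.\<close>

definition shc :: "real \<Rightarrow> real \<Rightarrow> real" where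
  "shc s x = (if s = 0 then x else sinh (s * x) / s)"

text \<open>With \<open>s\<^sup>2 = 4 \<omega> - c\<^sup>2\<close>, the density \<open>dens = \<Phi>\<^sup>2\<close> has
  \<open>2 / \<Phi>\<^sup>2 = (B cosh (s x) - c) / s\<^sup>2\<close>, where \<open>B = amp\<close>.
  Since \<open>B\<^sup>2 - c\<^sup>2 = g s\<^sup>2\<close>, the part \<open>(B - c) / s\<^sup>2\<close> equals \<open>g / (B + c)\<close>, which removes the
  singularity at \<open>s = 0\<close>.  Finally \<open>logd = \<Phi>' / \<Phi>\<close>.\<close>

definition amp :: "real \<Rightarrow> real \<Rightarrow> real \<Rightarrow> real" where
  "amp g c s = sqrt (c\<^sup>2 + g * s\<^sup>2)"

definition recip :: "real \<Rightarrow> real \<Rightarrow> real \<Rightarrow> real \<Rightarrow> real" where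
  "recip g c s x = g / (amp g c s + c) + 2 * amp g c s * (shc s (x / 2))\<^sup>2"

definition dens :: "real \<Rightarrow> real \<Rightarrow> real \<Rightarrow> real \<Rightarrow> real" where
  "dens g c s x = 2 / recip g c s x"

definition logd :: "real \<Rightarrow> real \<Rightarrow> real \<Rightarrow> real \<Rightarrow> real" where
  "logd g c s x = - (amp g c s * shc s x) / (2 * recip g c s x)"

section \<open>Growth, doubling formulas and parameter continuity of \<open>shc\<close>\<close>

lemma shc_DERIV: "(shc s has_real_derivative cosh (s * x)) (at x)"
proof (cases "s = 0")
  case True
  then have "shc s = (\<lambda>x. x)" by (simp add: shc_def fun_eq_iff)
  then show ?thesis using True by simp
next
  case False
  then have "shc s = (\<lambda>x. sinh (s * x) / s)" by (simp add: shc_def fun_eq_iff)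
  then show ?thesis using False by (auto intro!: derivative_eq_intros)
qed

lemma abs_sinh_ge: "\<bar>x\<bar> \<le> \<bar>sinh (x::real)\<bar>"
proof -
  have "x \<le> sinh x" if "x \<ge> 0" for x :: real
  proof -
    have "sinh 0 - 0 \<le> sinh x - x"
      by (rule DERIV_nonneg_imp_nondecreasing[OF that])
         (auto intro!: exI derivative_eq_intros simp: cosh_real_ge_1)
    then show ?thesis by simp
  qed
  from this[of "\<bar>x\<bar>"] show ?thesis by simp
qed

lemma abs_shc_ge: "\<bar>x\<bar> \<le> \<bar>shc s x\<bar>"
proof (cases "s = 0")
  case False
  then show ?thesis
    using abs_sinh_ge[of "s * x"] by (simp add: shc_def abs_mult field_simps)
qed (simp add: shc_def)

text \<open>Doubling formula for sinh, with cosh eliminated. It expresses the square of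
  \<open>shc\<close> through the half-argument term that occurs in \<open>recip\<close>.\<close>

lemma shc_half: "(shc s x)\<^sup>2 = 4 * (shc s (x / 2))\<^sup>2 * (1 + s\<^sup>2 * (shc s (x / 2))\<^sup>2)"
proof (cases "s = 0")
  case False
  have "sinh (s * x) = 2 * sinh (s * x / 2) * cosh (s * x / 2)"
    using sinh_double[of "s * x / 2"] by simp
  then show ?thesis
    using False cosh_square_eq[of "s * x / 2"]
    by (simp add: shc_def power_mult_distrib power_divide)
qed (simp add: shc_def power2_eq_square)

lemma cosh_shc: "cosh (s * x) = 1 + 2 * s\<^sup>2 * (shc s (x / 2))\<^sup>2"
proof (cases "s = 0")
  case False
  have "cosh (s * x) = 1 + 2 * (sinh (s * x / 2))\<^sup>2"
    using cosh_double[of "s * x / 2"] cosh_square_eq[of "s * x / 2"] by simp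
  then show ?thesis
    using False by (simp add: shc_def power_divide)
qed simp

lemma shc_double: "2 * shc s (x / 2) * cosh (s * (x / 2)) = shc s x"
  using sinh_double[of "s * x / 2"] by (simp add: shc_def)

text \<open>At \<open>s0 = 0\<close> the quotient \<open>sinh (s * x) / s\<close> is the difference
  quotient of \<open>sinh (s * x)\<close> in \<open>s\<close>, whose derivative at 0 is
  \<open>x\<close>, the value chosen in the definition.\<close>

lemma shc_tendsto:
  assumes "s \<longlonglongrightarrow> s0"
  shows "(\<lambda>n. shc (s n) x) \<longlonglongrightarrow> shc s0 x"
proof -
  have "isCont (\<lambda>s. shc s x) s0"
  proof (cases "s0 = 0")
    case True
    have "((\<lambda>s. sinh (s * x)) has_real_derivative x) (at 0)"
      by (auto intro!: derivative_eq_intros)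
    then have "((\<lambda>s. sinh (s * x) / s) \<longlongrightarrow> x) (at 0)"
      by (simp add: has_field_derivative_iff)
    then have "((\<lambda>s. shc s x) \<longlongrightarrow> x) (at 0)"
      by (rule Lim_transform_eventually) (auto simp: shc_def eventually_at_filter)
    then show ?thesis
      using True by (simp add: isCont_def shc_def)
  next
    case False
    have "isCont (\<lambda>s. sinh (s * x) / s) s0"
      using False by (intro continuous_intros) auto
    then show ?thesis
    proof (rule isCont_cong[THEN iffD1, rotated])
      show "\<forall>\<^sub>F s in nhds s0. sinh (s * x) / s = shc s x"
        using t1_space_nhds[OF False] by eventually_elim (simp add: shc_def)
    qed
  qed
  then show ?thesis
    using assms by (rule isCont_tendsto_compose)
qed

section \<open>Differential equations and bounds at fixed parameters\<close>

locale soliton =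
  fixes g c s :: real
  assumes g_pos: "g > 0" and c_pos: "c > 0" and s_nonneg: "s \<ge> 0"
begin

lemma amp_square: "(amp g c s)\<^sup>2 = c\<^sup>2 + g * s\<^sup>2"
  using g_pos by (simp add: amp_def)

lemma amp_ge: "c \<le> amp g c s"
  using g_pos c_pos by (simp add: amp_def real_le_rsqrt)

lemma amp_pos: "0 < amp g c s"
  using amp_ge c_pos by simp

lemma amp_diff: "s\<^sup>2 * (g / (amp g c s + c)) = amp g c s - c"
  using amp_square amp_pos c_pos by (simp add: field_simps power2_eq_square)

text \<open>Replacing \<open>shc\<close> by its linear lower bound gives quadratic growth in
  \<open>x\<close> that does not degenerate as \<open>s\<close> tends to 0.\<close>

lemma recip_ge: "g / (amp g c s + c) + amp g c s * x\<^sup>2 / 2 \<le> recip g c s x"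
proof -
  have "\<bar>x / 2\<bar>\<^sup>2 \<le> \<bar>shc s (x / 2)\<bar>\<^sup>2"
    by (intro power_mono abs_shc_ge) auto
  then have "amp g c s * (x\<^sup>2 / 4) \<le> amp g c s * (shc s (x / 2))\<^sup>2"
    using amp_pos by (intro mult_left_mono) (auto simp: power_divide)
  then show ?thesis by (simp add: recip_def)
qed

lemma recip_pos: "recip g c s x > 0"
proof -
  have "0 < g / (amp g c s + c)" "0 \<le> amp g c s * x\<^sup>2 / 2"
    using g_pos c_pos amp_pos by auto
  then show ?thesis using recip_ge[of x] by linarith
qed

lemma dens_pos: "dens g c s x > 0"
  using recip_pos by (simp add: dens_def)

text \<open>Ties \<open>recip\<close> to the denominator of the explicit profile; multiplied out by
  the square of \<open>s\<close>, the identity also covers \<open>s = 0\<close>.\<close>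

lemma amp_cosh: "amp g c s * cosh (s * x) = s\<^sup>2 * recip g c s x + c"
  using amp_diff unfolding cosh_shc[of s x] recip_def by (simp add: algebra_simps)

lemma recip_DERIV: "(recip g c s has_real_derivative amp g c s * shc s x) (at x)"
proof -
  have half: "((\<lambda>x. shc s (x / 2)) has_real_derivative cosh (s * (x / 2)) * (1 / 2)) (at x)"
    by (rule DERIV_chain2[OF shc_DERIV]) (auto intro!: derivative_eq_intros)
  have "((\<lambda>x. g / (amp g c s + c) + 2 * amp g c s * (shc s (x / 2))\<^sup>2) has_real_derivative
      0 + 2 * amp g c s * (of_nat 2 * (cosh (s * (x / 2)) * (1 / 2) * shc s (x / 2) ^ (2 - Suc 0)))) (at x)"
    by (intro DERIV_add DERIV_const DERIV_cmult DERIV_power half)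
  then show ?thesis
    unfolding recip_def [abs_def]
    by (rule DERIV_cong) (simp add: shc_double[of s x, symmetric])
qed

lemma dens_DERIV: "(dens g c s has_real_derivative 2 * logd g c s x * dens g c s x) (at x)"
proof -
  have "((\<lambda>x. 2 / recip g c s x) has_real_derivative
      (0 * recip g c s x - 2 * (amp g c s * shc s x)) / (recip g c s x * recip g c s x)) (at x)"
    using recip_pos[of x] by (intro DERIV_divide DERIV_const recip_DERIV) simp
  moreover have "(0 * recip g c s x - 2 * (amp g c s * shc s x)) / (recip g c s x * recip g c s x) =
      2 * logd g c s x * dens g c s x"
    by (simp add: logd_def dens_def)
  ultimately show ?thesis
    unfolding dens_def [abs_def] by simp
qed

text \<open>After the quotient rule, \<open>amp_cosh\<close> removes cosh, leaving only a polynomial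
  in \<open>logd\<close> and \<open>dens\<close>.\<close>

lemma logd_DERIV:
  "(logd g c s has_real_derivative
     2 * (logd g c s x)\<^sup>2 - s\<^sup>2 / 2 - c * dens g c s x / 4) (at x)"
proof -
  define B E J where "B = amp g c s" and "E = recip g c s x" and "J = shc s x"
  have E: "E > 0" and BE: "B * cosh (s * x) = s\<^sup>2 * E + c"
    using recip_pos amp_cosh by (simp_all add: E_def B_def)
  have "((\<lambda>x. - (amp g c s * shc s x) / (2 * recip g c s x)) has_real_derivative
      ((- (B * cosh (s * x))) * (2 * E) - (- (B * J)) * (2 * (B * J))) / ((2 * E) * (2 * E))) (at x)"
    unfolding B_def E_def J_def using recip_pos[of x]
    by (intro DERIV_divide DERIV_cmult DERIV_minus recip_DERIV shc_DERIV) simp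
  then have "(logd g c s has_real_derivative
      ((- (B * cosh (s * x))) * (2 * E) - (- (B * J)) * (2 * (B * J))) / ((2 * E) * (2 * E))) (at x)"
    unfolding logd_def [abs_def] .
  then show ?thesis
  proof (rule DERIV_cong)
    have eqs: "logd g c s x = - (B * J) / (2 * E)" "dens g c s x = 2 / E"
      by (simp_all add: logd_def dens_def B_def E_def J_def)
    show "((- (B * cosh (s * x))) * (2 * E) - (- (B * J)) * (2 * (B * J))) / ((2 * E) * (2 * E)) =
        2 * (logd g c s x)\<^sup>2 - s\<^sup>2 / 2 - c * dens g c s x / 4"
      unfolding BE eqs using E by (simp add: field_simps power2_eq_square)
  qed
qed

text \<open>The equations have the first integral h^2 = s^2/4 + c F/4 - g F^2/16 with h =
  \<open>logd\<close> and F = \<open>dens\<close>; the bound drops the last term.\<close>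

lemma logd_square_le: "(logd g c s x)\<^sup>2 \<le> s\<^sup>2 / 4 + c * dens g c s x / 4"
proof -
  define B E where "B = amp g c s" and "E = recip g c s x"
  have E: "E > 0"
    using recip_pos by (simp add: E_def)
  have "(B * shc s x)\<^sup>2 = s\<^sup>2 * E\<^sup>2 + 2 * c * E - g"
  proof -
    \<comment> \<open>\<open>p\<close> is the value of \<open>recip\<close> at 0. The relations for
      \<open>s\<^sup>2 * p\<close> and \<open>p * (B + c)\<close> turn the claim into a polynomial
      identity.\<close>
    define q p where "q = (shc s (x / 2))\<^sup>2" and "p = g / (B + c)"
    have E_eq: "E = p + 2 * B * q"
      by (simp add: E_def recip_def B_def p_def q_def)
    have sp: "s\<^sup>2 * p = B - c" and pg: "p * (B + c) = g"
      using amp_diff amp_pos c_pos by (simp_all add: p_def B_def)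
    have "s\<^sup>2 * E\<^sup>2 = p * (s\<^sup>2 * p) + 4 * B * q * (s\<^sup>2 * p) + 4 * s\<^sup>2 * B\<^sup>2 * q\<^sup>2"
      unfolding E_eq by (simp add: power2_eq_square algebra_simps)
    then have "s\<^sup>2 * E\<^sup>2 + 2 * c * E - g = B\<^sup>2 * (4 * q * (1 + s\<^sup>2 * q))"
      unfolding sp unfolding E_eq pg[symmetric] by (simp add: power2_eq_square algebra_simps)
    then show ?thesis
      by (simp add: power_mult_distrib shc_half[of s x] q_def)
  qed
  then have "(logd g c s x)\<^sup>2 = (s\<^sup>2 * E\<^sup>2 + 2 * c * E - g) / (2 * E)\<^sup>2"
    by (simp add: logd_def B_def E_def power_divide)
  also have "\<dots> \<le> (s\<^sup>2 * E\<^sup>2 + 2 * c * E) / (2 * E)\<^sup>2"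
    using g_pos by (intro divide_right_mono) auto
  also have "\<dots> = s\<^sup>2 / 4 + c * dens g c s x / 4"
    using E by (simp add: dens_def E_def[symmetric] field_simps power2_eq_square)
  finally show ?thesis .
qed

end

section \<open>Pointwise limits in the parameters and uniform decay of the density\<close>

lemma amp_tendsto:
  assumes "c \<longlonglongrightarrow> c0" "s \<longlonglongrightarrow> s0"
  shows "(\<lambda>n. amp g (c n) (s n)) \<longlonglongrightarrow> amp g c0 s0"
  unfolding amp_def by (intro tendsto_intros assms)

lemma recip_tendsto:
  assumes "soliton g c0 s0" "c \<longlonglongrightarrow> c0" "s \<longlonglongrightarrow> s0"
  shows "(\<lambda>n. recip g (c n) (s n) x) \<longlonglongrightarrow> recip g c0 s0 x"
  unfolding recip_def
  using soliton.amp_pos[OF assms(1)] soliton.c_pos[OF assms(1)]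
  by (intro tendsto_intros amp_tendsto shc_tendsto assms) simp

lemma dens_tendsto:
  assumes "soliton g c0 s0" "c \<longlonglongrightarrow> c0" "s \<longlonglongrightarrow> s0"
  shows "(\<lambda>n. dens g (c n) (s n) x) \<longlonglongrightarrow> dens g c0 s0 x"
  unfolding dens_def
  using soliton.recip_pos[OF assms(1), of x]
  by (intro tendsto_intros recip_tendsto assms) simp

lemma logd_tendsto:
  assumes "soliton g c0 s0" "c \<longlonglongrightarrow> c0" "s \<longlonglongrightarrow> s0"
  shows "(\<lambda>n. logd g (c n) (s n) x) \<longlonglongrightarrow> logd g c0 s0 x"
  unfolding logd_def
  using soliton.recip_pos[OF assms(1), of x]
  by (intro tendsto_intros recip_tendsto amp_tendsto shc_tendsto assms) simp

lemma dens_uniform_decay: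
  assumes "g > 0" "l > 0"
  obtains K where "K > 0"
    "\<And>c s x. \<lbrakk>l \<le> c; c \<le> u; 0 \<le> s; s \<le> S\<rbrakk> \<Longrightarrow> dens g c s x \<le> K / (1 + x\<^sup>2)"
proof -
  \<comment> \<open>\<open>M\<close> dominates \<open>amp g c s + c\<close> over the parameter box,
    its summand 1 making it positive. Then \<open>\<kappa>\<close> lies below both coefficients in
    \<open>recip_ge\<close>: the constant term is at least \<open>g / M\<close>, and
    \<open>amp g c s / 2\<close> is at least \<open>l / 2\<close>.\<close>
  define M where "M = sqrt (u\<^sup>2 + g * S\<^sup>2) + \<bar>u\<bar> + 1"
  define \<kappa> where "\<kappa> = min (g / M) (l / 2)"
  have M: "M > 0"
    using assms by (auto simp: M_def intro!: add_nonneg_pos)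
  then have \<kappa>: "\<kappa> > 0"
    using assms by (simp add: \<kappa>_def)
  show ?thesis
  proof (rule that[of "2 / \<kappa>"])
    fix c s x :: real assume *: "l \<le> c" "c \<le> u" "0 \<le> s" "s \<le> S"
    interpret soliton g c s using * assms by unfold_locales auto
    have "amp g c s \<le> sqrt (u\<^sup>2 + g * S\<^sup>2)"
      unfolding amp_def using * assms
      by (intro real_sqrt_le_mono add_mono mult_left_mono power_mono) auto
    then have "amp g c s + c \<le> M"
      using * by (simp add: M_def)
    then have "g / M \<le> g / (amp g c s + c)"
      using amp_pos c_pos g_pos by (intro divide_left_mono) auto
    then have 1: "\<kappa> \<le> g / (amp g c s + c)"
      by (simp add: \<kappa>_def)
    have "\<kappa> \<le> amp g c s / 2"
      using amp_ge * by (simp add: \<kappa>_def min_def)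
    then have 2: "\<kappa> * x\<^sup>2 \<le> amp g c s / 2 * x\<^sup>2"
      by (rule mult_right_mono) simp
    have "\<kappa> * (1 + x\<^sup>2) \<le> recip g c s x"
      using recip_ge[of x] 1 2 by (simp add: algebra_simps)
    moreover have "0 < \<kappa> * (1 + x\<^sup>2)"
      using \<kappa> by (intro mult_pos_pos add_pos_nonneg) auto
    ultimately have "2 / recip g c s x \<le> 2 / (\<kappa> * (1 + x\<^sup>2))"
      by (intro divide_left_mono mult_pos_pos[OF recip_pos]) auto
    then show "dens g c s x \<le> 2 / \<kappa> / (1 + x\<^sup>2)"
      by (simp add: dens_def)
  qed (use \<kappa> in simp)
qed

subsection \<open>The profile and its derivatives\<close>

definition phase :: "real \<Rightarrow> real \<Rightarrow> real \<Rightarrow> real \<Rightarrow> real" where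
  "phase g c s x = (LINT y:{..x}|lebesgue. dens g c s y)"

definition prof :: "real \<Rightarrow> real \<Rightarrow> real \<Rightarrow> real \<Rightarrow> complex" where
  "prof g c s x = complex_of_real (sqrt (dens g c s x)) *
     exp (\<i> / 2 * complex_of_real (c * x) - \<i> / 4 * complex_of_real (phase g c s x))"

context soliton
begin

lemma dens_continuous: "continuous_on A (dens g c s)"
  using dens_DERIV by (intro continuous_at_imp_continuous_on ballI DERIV_isCont)

lemma dens_integrable: "integrable lebesgue (dens g c s)"
proof -
  \<comment> \<open>The uniform estimate is used with the range of \<open>c\<close> shrunk to a
    single point and \<open>s\<close> as its own upper bound.\<close>
  obtain K where "K > 0"
    "\<And>c' s' x. \<lbrakk>c \<le> c'; c' \<le> c; 0 \<le> s'; s' \<le> s\<rbrakk> \<Longrightarrow> dens g c' s' x \<le> K / (1 + x\<^sup>2)"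
    using dens_uniform_decay[OF g_pos c_pos] by blast
  then have K: "dens g c s x \<le> K / (1 + x\<^sup>2)" for x
    using s_nonneg by simp
  show ?thesis
  proof (rule Bochner_Integration.integrable_bound[OF integrable_inverse_1_plus_square_lebesgue[of K]])
    show "dens g c s \<in> borel_measurable lebesgue"
      by (intro continuous_borel_measurable_lebesgue dens_continuous)
    show "AE x in lebesgue. norm (dens g c s x) \<le> norm (K / (1 + x\<^sup>2))"
    proof (rule AE_I2)
      fix x show "norm (dens g c s x) \<le> norm (K / (1 + x\<^sup>2))"
        using K[of x] dens_pos[of x] by (simp only: real_norm_def)
    qed
  qed
qed

lemma dens_set_integrable: "A \<in> sets lebesgue \<Longrightarrow> set_integrable lebesgue A (dens g c s)"
  unfolding set_integrable_def using dens_integrable by (intro integrable_mult_indicator)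

text \<open>Splitting the half-line at \<open>x - 1\<close> leaves a constant plus an integral over
  a compact interval with \<open>x\<close> in the interior of its range.\<close>

lemma phase_DERIV: "(phase g c s has_real_derivative dens g c s x) (at x)"
proof -
  have "phase g c s y = phase g c s (x - 1) + integral {x - 1..y} (dens g c s)" if "x - 1 < y" for y
  proof -
    have "phase g c s y = phase g c s (x - 1) + (LINT z:{x - 1<..y}|lebesgue. dens g c s z)"
    proof -
      have eq: "{..y} = {..x - 1} \<union> {x - 1<..y}" using that by auto
      show ?thesis
        unfolding phase_def eq by (rule set_integral_Un) (auto intro!: dens_set_integrable)
    qed
    also have "(LINT z:{x - 1<..y}|lebesgue. dens g c s z) = integral {x - 1<..y} (dens g c s)"
      by (intro set_lebesgue_integral_eq_integral dens_set_integrable) auto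
    also have "\<dots> = integral {x - 1..y} (dens g c s)"
      by (rule integral_spike_set) (auto intro: negligible_subset[of "{x - 1}"])
    finally show ?thesis .
  qed
  moreover have "((\<lambda>y. phase g c s (x - 1) + integral {x - 1..y} (dens g c s))
      has_real_derivative dens g c s x) (at x)"
  proof -
    have "((\<lambda>y. integral {x - 1..y} (dens g c s)) has_real_derivative dens g c s x) (at x within {x - 1..x + 1})"
      by (intro integral_has_real_derivative dens_continuous) auto
    then have "((\<lambda>y. integral {x - 1..y} (dens g c s)) has_real_derivative dens g c s x) (at x)"
      by (simp add: at_within_Icc_at)
    then show ?thesis
      by (auto intro!: derivative_eq_intros)
  qed
  ultimately show ?thesis
    \<comment> \<open>The splitting holds only for \<open>y > x - 1\<close>, which is a
      neighbourhood of \<open>x\<close>.\<close>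
    by (subst DERIV_cong_ev[OF refl _ refl])
       (auto intro!: eventually_mono[OF eventually_nhds_in_open[of "{x - 1<..}"]])
qed

text \<open>The exponent is purely imaginary, so the phase drops out and decay of the density gives
  decay of the profile.\<close>

lemma prof_norm: "(norm (prof g c s x))\<^sup>2 = dens g c s x"
  using dens_pos[of x] by (simp add: prof_def norm_mult power_mult_distrib less_imp_le)

lemma prof_has_vector_derivative:
  "(prof g c s has_vector_derivative
     prof g c s x * (logd g c s x + \<i> / 2 * c - \<i> / 4 * dens g c s x)) (at x)"
proof -
  have r: "((\<lambda>x. sqrt (dens g c s x)) has_real_derivative logd g c s x * sqrt (dens g c s x)) (at x)"
  proof -
    have "((\<lambda>x. sqrt (dens g c s x)) has_real_derivative
        inverse (sqrt (dens g c s x)) / 2 * (2 * logd g c s x * dens g c s x)) (at x)"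
      by (rule DERIV_chain2[OF DERIV_real_sqrt dens_DERIV]) (rule dens_pos)
    moreover have "inverse (sqrt (dens g c s x)) / 2 * (2 * logd g c s x * dens g c s x) = logd g c s x * sqrt (dens g c s x)"
      using dens_pos[of x] by (simp add: field_simps less_imp_le)
    ultimately show ?thesis by (simp only:)
  qed
  have "((\<lambda>x. \<i> / 2 * complex_of_real (c * x) - \<i> / 4 * complex_of_real (phase g c s x))
      has_vector_derivative \<i> / 2 * c - \<i> / 4 * dens g c s x) (at x)"
    using phase_DERIV
    by (intro has_vector_derivative_diff has_vector_derivative_mult_right has_vector_derivative_of_real)
       (auto intro!: derivative_eq_intros simp flip: has_real_derivative_iff_has_vector_derivative)
  from field_vector_diff_chain_at[OF this DERIV_exp]
  have e: "((\<lambda>x. exp (\<i> / 2 * complex_of_real (c * x) - \<i> / 4 * complex_of_real (phase g c s x)))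
      has_vector_derivative (\<i> / 2 * c - \<i> / 4 * dens g c s x) *
        exp (\<i> / 2 * complex_of_real (c * x) - \<i> / 4 * complex_of_real (phase g c s x))) (at x)"
    by (simp add: o_def)
  have r': "((\<lambda>x. complex_of_real (sqrt (dens g c s x))) has_vector_derivative
      complex_of_real (logd g c s x * sqrt (dens g c s x))) (at x)"
    using r by (intro has_vector_derivative_of_real) (simp flip: has_real_derivative_iff_has_vector_derivative)
  show ?thesis
    unfolding prof_def [abs_def]
    by (rule has_vector_derivative_eq_rhs[OF has_vector_derivative_mult[OF r' e]])
       (simp add: algebra_simps)
qed

end

text \<open>Polynomials in \<open>\<Phi>' / \<Phi>\<close>, \<open>\<Phi>\<^sup>2\<close>, \<open>c\<close> and \<open>s\<^sup>2\<close>.  They are closed under \<open>d/dx\<close>, because the first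
  two solve a polynomial differential equation with coefficients in the last two.\<close>

datatype jet = Const complex | Logd | Dens | Speed | Gap | Add jet jet | Mult jet jet

fun eval_jet :: "jet \<Rightarrow> complex \<Rightarrow> complex \<Rightarrow> complex \<Rightarrow> complex \<Rightarrow> complex" where
  "eval_jet (Const z) h f c a = z"
| "eval_jet Logd h f c a = h"
| "eval_jet Dens h f c a = f"
| "eval_jet Speed h f c a = c"
| "eval_jet Gap h f c a = a"
| "eval_jet (Add p q) h f c a = eval_jet p h f c a + eval_jet q h f c a"
| "eval_jet (Mult p q) h f c a = eval_jet p h f c a * eval_jet q h f c a"

fun diff_jet :: "jet \<Rightarrow> jet" where
  "diff_jet (Const z) = Const 0"
| "diff_jet Logd = Add (Mult (Const 2) (Mult Logd Logd))
     (Add (Mult (Const (- 1 / 2)) Gap) (Mult (Const (- 1 / 4)) (Mult Speed Dens)))"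
| "diff_jet Dens = Mult (Const 2) (Mult Logd Dens)"
| "diff_jet Speed = Const 0"
| "diff_jet Gap = Const 0"
| "diff_jet (Add p q) = Add (diff_jet p) (diff_jet q)"
| "diff_jet (Mult p q) = Add (Mult (diff_jet p) q) (Mult p (diff_jet q))"

text \<open>Product rule for the profile times a jet: differentiating the jet gives the first
  summand, and the logarithmic derivative of the profile supplies the factor in the second.\<close>

fun prof_jet :: "nat \<Rightarrow> jet" where
  "prof_jet 0 = Const 1"
| "prof_jet (Suc k) = Add (diff_jet (prof_jet k)) (Mult (prof_jet k)
     (Add Logd (Add (Mult (Const (\<i> / 2)) Speed) (Mult (Const (- \<i> / 4)) Dens))))"

definition prof_deriv :: "real \<Rightarrow> real \<Rightarrow> real \<Rightarrow> nat \<Rightarrow> real \<Rightarrow> complex" where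
  "prof_deriv g c s k x = prof g c s x * eval_jet (prof_jet k) (logd g c s x) (dens g c s x) c (s\<^sup>2)"

lemma prof_deriv_0: "prof_deriv g c s 0 = prof g c s"
  by (simp add: prof_deriv_def fun_eq_iff)

lemma eval_jet_tendsto:
  assumes "(h \<longlongrightarrow> h0) F" "(f \<longlongrightarrow> f0) F" "(c \<longlongrightarrow> c0) F" "(a \<longlongrightarrow> a0) F"
  shows "((\<lambda>n. eval_jet p (h n) (f n) (c n) (a n)) \<longlongrightarrow> eval_jet p h0 f0 c0 a0) F"
  by (induction p) (auto intro!: tendsto_intros assms)

lemma eval_jet_bounded:
  "\<exists>M\<ge>0. \<forall>h f c a. norm h \<le> R \<longrightarrow> norm f \<le> R \<longrightarrow> norm c \<le> R \<longrightarrow> norm a \<le> R \<longrightarrow> norm (eval_jet p h f c a) \<le> M"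
proof (induction p)
  case (Const z)
  show ?case by (intro exI[of _ "norm z"]) simp
next
  case (Add p q)
  then obtain M N where "M \<ge> 0" "N \<ge> 0"
    "\<forall>h f c a. norm h \<le> R \<longrightarrow> norm f \<le> R \<longrightarrow> norm c \<le> R \<longrightarrow> norm a \<le> R \<longrightarrow> norm (eval_jet p h f c a) \<le> M"
    "\<forall>h f c a. norm h \<le> R \<longrightarrow> norm f \<le> R \<longrightarrow> norm c \<le> R \<longrightarrow> norm a \<le> R \<longrightarrow> norm (eval_jet q h f c a) \<le> N"
    by blast
  then show ?case
    by (intro exI[of _ "M + N"]) (auto intro!: norm_triangle_mono)
next
  case (Mult p q)
  then obtain M N where "M \<ge> 0" "N \<ge> 0"
    "\<forall>h f c a. norm h \<le> R \<longrightarrow> norm f \<le> R \<longrightarrow> norm c \<le> R \<longrightarrow> norm a \<le> R \<longrightarrow> norm (eval_jet p h f c a) \<le> M"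
    "\<forall>h f c a. norm h \<le> R \<longrightarrow> norm f \<le> R \<longrightarrow> norm c \<le> R \<longrightarrow> norm a \<le> R \<longrightarrow> norm (eval_jet q h f c a) \<le> N"
    by blast
  then show ?case
    by (intro exI[of _ "M * N"]) (auto simp: norm_mult intro!: mult_mono)
\<comment> \<open>\<open>R\<close> may be negative; the premises are then void, but the witness must
  still be nonnegative.\<close>
qed (auto intro!: exI[of _ "max R 0"])

context soliton
begin

lemma eval_jet_has_vector_derivative:
  "((\<lambda>x. eval_jet p (logd g c s x) (dens g c s x) c (s\<^sup>2)) has_vector_derivative
     eval_jet (diff_jet p) (logd g c s x) (dens g c s x) c (s\<^sup>2)) (at x)"
proof (induction p)
  case Logd
  have "((\<lambda>x. complex_of_real (logd g c s x)) has_vector_derivative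
      of_real (2 * (logd g c s x)\<^sup>2 - s\<^sup>2 / 2 - c * dens g c s x / 4)) (at x)"
    using logd_DERIV by (intro has_vector_derivative_of_real) (simp flip: has_real_derivative_iff_has_vector_derivative)
  then show ?case by (simp add: power2_eq_square algebra_simps)
next
  case Dens
  have "((\<lambda>x. complex_of_real (dens g c s x)) has_vector_derivative
      of_real (2 * logd g c s x * dens g c s x)) (at x)"
    using dens_DERIV by (intro has_vector_derivative_of_real) (simp flip: has_real_derivative_iff_has_vector_derivative)
  then show ?case by (simp add: mult.assoc)
next
  case (Add p q)
  then show ?case by (auto intro!: has_vector_derivative_add)
next
  case (Mult p q)
  then show ?case
    using has_vector_derivative_mult[OF Mult] by (simp add: add.commute)
qed auto

lemma prof_deriv_has_vector_derivative:
  "(prof_deriv g c s k has_vector_derivative prof_deriv g c s (Suc k) x) (at x)"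
  unfolding prof_deriv_def [abs_def]
  by (rule has_vector_derivative_eq_rhs
        [OF has_vector_derivative_mult[OF prof_has_vector_derivative eval_jet_has_vector_derivative]])
     (simp add: algebra_simps)

end

section \<open>Convergence and uniform domination of all derivatives of the profile\<close>

lemma phase_tendsto:
  assumes "g > 0" "l > 0" and "soliton g c0 s0"
    and c: "\<And>n. l \<le> c n" "\<And>n. c n \<le> u" "c \<longlonglongrightarrow> c0"
    and s: "\<And>n. 0 \<le> s n" "\<And>n. s n \<le> S" "s \<longlonglongrightarrow> s0"
  shows "(\<lambda>n. phase g (c n) (s n) x) \<longlonglongrightarrow> phase g c0 s0 x"
proof -
  interpret lim: soliton g c0 s0 by fact
  have sol: "soliton g (c n) (s n)" for n
    using assms(1,2) c(1)[of n] s(1)[of n] by unfold_locales auto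
  obtain K where K: "K > 0"
    "\<And>c s x. \<lbrakk>l \<le> c; c \<le> u; 0 \<le> s; s \<le> S\<rbrakk> \<Longrightarrow> dens g c s x \<le> K / (1 + x\<^sup>2)"
    using dens_uniform_decay[OF assms(1,2)] by blast
  have meas: "soliton g c s \<Longrightarrow> (\<lambda>y. indicator {..x} y *\<^sub>R dens g c s y) \<in> borel_measurable lebesgue" for c s
    using soliton.dens_set_integrable[of g c s "{..x}"] unfolding set_integrable_def by auto
  show ?thesis
    unfolding phase_def set_lebesgue_integral_def
  \<comment> \<open>All parameters stay in one box, so a single majorant
    \<open>K / (1 + y\<^sup>2)\<close> serves every \<open>n\<close>.\<close>
  proof (rule integral_dominated_convergence)
    show "AE y in lebesgue. (\<lambda>n. indicator {..x} y *\<^sub>R dens g (c n) (s n) y) \<longlonglongrightarrow> indicator {..x} y *\<^sub>R dens g c0 s0 y"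
      by (intro AE_I2 tendsto_intros dens_tendsto assms)
    show "AE y in lebesgue. norm (indicator {..x} y *\<^sub>R dens g (c n) (s n) y) \<le> K / (1 + y\<^sup>2)" for n
    proof (rule AE_I2)
      fix y
      have "0 < dens g (c n) (s n) y" "dens g (c n) (s n) y \<le> K / (1 + y\<^sup>2)"
        using soliton.dens_pos[OF sol] K(2) c s by auto
      then show "norm (indicator {..x} y *\<^sub>R dens g (c n) (s n) y) \<le> K / (1 + y\<^sup>2)"
        by (auto simp: indicator_def)
    qed
  qed (use meas sol assms(3) integrable_inverse_1_plus_square_lebesgue in auto)
qed

lemma prof_deriv_tendsto:
  assumes "g > 0" "l > 0" and "soliton g c0 s0"
    and c: "\<And>n. l \<le> c n" "\<And>n. c n \<le> u" "c \<longlonglongrightarrow> c0"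
    and s: "\<And>n. 0 \<le> s n" "\<And>n. s n \<le> S" "s \<longlonglongrightarrow> s0"
  shows "(\<lambda>n. prof_deriv g (c n) (s n) k x) \<longlonglongrightarrow> prof_deriv g c0 s0 k x"
  unfolding prof_deriv_def prof_def
  by (intro tendsto_intros eval_jet_tendsto phase_tendsto[OF assms] dens_tendsto logd_tendsto assms)

lemma prof_deriv_uniform_decay:
  assumes "g > 0" "l > 0"
  shows "\<exists>C. \<forall>c s x. l \<le> c \<longrightarrow> c \<le> u \<longrightarrow> 0 \<le> s \<longrightarrow> s \<le> S \<longrightarrow> (norm (prof_deriv g c s k x))\<^sup>2 \<le> C / (1 + x\<^sup>2)"
proof -
  obtain K where K: "K > 0"
    "\<And>c s x. \<lbrakk>l \<le> c; c \<le> u; 0 \<le> s; s \<le> S\<rbrakk> \<Longrightarrow> dens g c s x \<le> K / (1 + x\<^sup>2)"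
    using dens_uniform_decay[OF assms] by blast
  \<comment> \<open>One radius for all four arguments of the jet: \<open>logd\<close> enters through
    |h| <= 1 + h^2 and \<open>logd_square_le\<close>, the others through the bounds
    \<open>K\<close>, \<open>\<bar>u\<bar>\<close> and \<open>S\<^sup>2\<close>.\<close>
  define R where "R = 1 + S\<^sup>2 + \<bar>u\<bar> * K + K + \<bar>u\<bar>"
  obtain M where M: "M \<ge> 0" "\<And>h f c a. \<lbrakk>norm h \<le> R; norm f \<le> R; norm c \<le> R; norm a \<le> R\<rbrakk> \<Longrightarrow>
      norm (eval_jet (prof_jet k) h f c a) \<le> M"
    using eval_jet_bounded by blast
  have "(norm (prof_deriv g c s k x))\<^sup>2 \<le> (K * M\<^sup>2) / (1 + x\<^sup>2)"
    if cs: "l \<le> c" "c \<le> u" "0 \<le> s" "s \<le> S" for c s x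
  proof -
    interpret soliton g c s using cs assms by unfold_locales auto
    have dens: "dens g c s x \<le> K / (1 + x\<^sup>2)"
      using K(2) cs by blast
    also have "\<dots> \<le> K / 1"
      using K(1) by (intro divide_left_mono) (auto intro: add_pos_nonneg)
    finally have dK: "dens g c s x \<le> K" by simp
    have s2: "s\<^sup>2 \<le> S\<^sup>2" using cs by (intro power_mono)
    have "c * dens g c s x \<le> \<bar>u\<bar> * K"
      using cs c_pos dK dens_pos[of x] by (intro mult_mono) auto
    then have "(logd g c s x)\<^sup>2 \<le> S\<^sup>2 + \<bar>u\<bar> * K"
      using logd_square_le[of x] s2 zero_le_power2[of S] mult_nonneg_nonneg[of "\<bar>u\<bar>" K] K(1) by linarith
    moreover have "\<bar>logd g c s x\<bar> \<le> 1 + (logd g c s x)\<^sup>2"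
    proof -
      have "0 \<le> (\<bar>logd g c s x\<bar> - 1)\<^sup>2 + \<bar>logd g c s x\<bar>" by simp
      also have "\<dots> = 1 + (logd g c s x)\<^sup>2 - \<bar>logd g c s x\<bar>"
        by (simp add: power2_eq_square algebra_simps)
      finally show ?thesis by simp
    qed
    moreover have "\<bar>u\<bar> * K \<ge> 0" "S\<^sup>2 \<ge> 0" using K(1) by auto
    ultimately have "\<bar>logd g c s x\<bar> \<le> R" "\<bar>dens g c s x\<bar> \<le> R" "\<bar>c\<bar> \<le> R" "\<bar>s\<^sup>2\<bar> \<le> R"
      using dK dens_pos[of x] s2 cs c_pos K(1) zero_le_power2[of s] unfolding R_def by linarith+
    then have "norm (eval_jet (prof_jet k) (logd g c s x) (dens g c s x) c (s\<^sup>2)) \<le> M"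
      by (intro M(2)) (simp_all only: norm_of_real)
    then have "(norm (eval_jet (prof_jet k) (logd g c s x) (dens g c s x) c (s\<^sup>2)))\<^sup>2 \<le> M\<^sup>2"
      by (intro power_mono) auto
    then have "(norm (prof_deriv g c s k x))\<^sup>2 \<le> (K / (1 + x\<^sup>2)) * M\<^sup>2"
      unfolding prof_deriv_def norm_mult power_mult_distrib prof_norm
      using dens dens_pos[of x] K(1) by (intro mult_mono) auto
    then show ?thesis by simp
  qed
  then show ?thesis by blast
qed

lemma sobolev_norm_prof_diff_tendsto_0:
  assumes "g > 0" "l > 0" and lim: "soliton g c0 s0"
    and c: "\<And>n. l \<le> c n" "\<And>n. c n \<le> u" "c \<longlonglongrightarrow> c0"
    and s: "\<And>n. 0 \<le> s n" "\<And>n. s n \<le> S" "s \<longlonglongrightarrow> s0"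
  shows "(\<lambda>n. sobolev_norm m (\<lambda>x. prof g (c n) (s n) x - prof g c0 s0 x)) \<longlonglongrightarrow> 0"
proof -
  have sol: "soliton g (c n) (s n)" for n
    using assms(1,2) c(1)[of n] s(1)[of n] by unfold_locales auto
  \<comment> \<open>The box is closed, so the limit parameters obey the same decay estimate.\<close>
  have lim_bounds: "l \<le> c0" "c0 \<le> u" "0 \<le> s0" "s0 \<le> S"
    using c s by (auto intro: LIMSEQ_le_const LIMSEQ_le_const2)
  obtain C where C: "\<And>k c s x. \<lbrakk>l \<le> c; c \<le> u; 0 \<le> s; s \<le> S\<rbrakk> \<Longrightarrow>
      (norm (prof_deriv g c s k x))\<^sup>2 \<le> C k / (1 + x\<^sup>2)"
    using prof_deriv_uniform_decay[OF assms(1,2), of u S] by metis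
  define f where "f n k x = prof_deriv g (c n) (s n) k x - prof_deriv g c0 s0 k x" for n k x
  have "(\<lambda>n. sobolev_norm m (f n 0)) \<longlonglongrightarrow> 0"
  proof (rule sobolev_norm_tendsto_0)
    show "(f n k has_vector_derivative f n (Suc k) x) (at x)" for n k x
      unfolding f_def [abs_def]
      by (intro has_vector_derivative_diff soliton.prof_deriv_has_vector_derivative sol lim)
    show "(\<lambda>n. f n k x) \<longlonglongrightarrow> 0" for k x
      unfolding f_def by (rule LIM_zero[OF prof_deriv_tendsto[OF assms]])
    show "(norm (f n k x))\<^sup>2 \<le> (4 * C k) / (1 + x\<^sup>2)" for n k x
    proof -
      define p q where "p = norm (prof_deriv g (c n) (s n) k x)" and "q = norm (prof_deriv g c0 s0 k x)"
      have "(norm (f n k x))\<^sup>2 \<le> (p + q)\<^sup>2"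
        unfolding f_def p_def q_def by (intro power_mono norm_triangle_ineq4) auto
      also have "\<dots> \<le> 2 * p\<^sup>2 + 2 * q\<^sup>2"
        using zero_le_power2[of "p - q"] by (simp add: power2_eq_square algebra_simps)
      also have "\<dots> \<le> 2 * (C k / (1 + x\<^sup>2)) + 2 * (C k / (1 + x\<^sup>2))"
        unfolding p_def q_def using C c s lim_bounds by (intro add_mono mult_left_mono) auto
      finally show ?thesis by simp
    qed
  qed
  then show ?thesis
    by (simp add: f_def [abs_def] prof_deriv_0)
qed

section \<open>Identification with the explicit solitons, and the limit\<close>

lemma \<Phi>_eq_dens:
  assumes "gam b > 0" "c > 0" "c \<le> 2 * sqrt \<omega>"
  shows "\<Phi> b \<omega> c x = sqrt (dens (gam b) c (sqrt (4 * \<omega> - c\<^sup>2)) x)"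
proof (cases "c = 2 * sqrt \<omega>")
  case True
  then have "\<omega> \<ge> 0" using assms by auto
  then have "4 * \<omega> - c\<^sup>2 = 0" using True by (simp add: power_mult_distrib)
  moreover have "dens (gam b) c 0 x = 4 * c / ((c * x)\<^sup>2 + gam b)"
  proof -
    have "recip (gam b) c 0 x = ((c * x)\<^sup>2 + gam b) / (2 * c)"
      using assms by (simp add: recip_def amp_def shc_def field_simps power2_eq_square)
    then show ?thesis by (simp add: dens_def)
  qed
  ultimately show ?thesis using True by (simp add: \<Phi>_def)
next
  case False
  have "c\<^sup>2 < (2 * sqrt \<omega>)\<^sup>2"
    using assms False by (intro power_strict_mono) auto
  \<comment> \<open>\<open>sqrt\<close> is odd on the reals, so a negative \<open>\<omega>\<close>
    would make \<open>2 * sqrt \<omega>\<close> negative, against \<open>0 < c\<close>.\<close>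
  moreover have "\<omega> \<ge> 0" using assms by (smt (verit) real_sqrt_lt_0_iff)
  ultimately have pos: "4 * \<omega> - c\<^sup>2 > 0" by (simp add: power_mult_distrib)
  define s where "s = sqrt (4 * \<omega> - c\<^sup>2)"
  have s: "s > 0" "s\<^sup>2 = 4 * \<omega> - c\<^sup>2" using pos by (simp_all add: s_def)
  interpret soliton "gam b" c s using assms s by unfold_locales auto
  have "amp (gam b) c s * cosh (s * x) - c = s\<^sup>2 * recip (gam b) c s x"
    by (simp add: amp_cosh)
  then have "2 * s\<^sup>2 / (amp (gam b) c s * cosh (s * x) - c) = dens (gam b) c s x"
    using s(1) by (simp add: dens_def)
  then show ?thesis
    using False unfolding \<Phi>_def s_def[symmetric] unfolding s(2)[symmetric] amp_def by simp
qed

lemma \<phi>_eq_prof: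
  assumes "gam b > 0" "c > 0" "c \<le> 2 * sqrt \<omega>"
  shows "\<phi> b \<omega> c = prof (gam b) c (sqrt (4 * \<omega> - c\<^sup>2))"
proof -
  have "c\<^sup>2 \<le> (2 * sqrt \<omega>)\<^sup>2"
    using assms by (intro power_mono) auto
  moreover have "\<omega> \<ge> 0" using assms by (smt (verit) real_sqrt_lt_0_iff)
  ultimately have "4 * \<omega> - c\<^sup>2 \<ge> 0" by (simp add: power_mult_distrib)
  then interpret soliton "gam b" c "sqrt (4 * \<omega> - c\<^sup>2)"
    using assms by unfold_locales auto
  have "\<bar>\<Phi> b \<omega> c y\<bar>\<^sup>2 = dens (gam b) c (sqrt (4 * \<omega> - c\<^sup>2)) y" for y
    using dens_pos[of y] by (simp add: \<Phi>_eq_dens[OF assms] less_imp_le)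
  then show ?thesis
    by (simp add: fun_eq_iff \<phi>_def prof_def phase_def \<Phi>_eq_dens[OF assms])
qed

theorem theorem1p1:
  fixes b \<omega>\<^sub>0 c\<^sub>0 :: real and m :: nat
  assumes "b > - 3 / 16"
    and "\<omega>\<^sub>0 > 0" and "c\<^sub>0 = 2 * sqrt \<omega>\<^sub>0"
  shows "((\<lambda>(\<omega>, c). sobolev_norm m (\<lambda>x. \<phi> b \<omega> c x - \<phi> b \<omega>\<^sub>0 c\<^sub>0 x)) \<longlongrightarrow> 0)
           (at (\<omega>\<^sub>0, c\<^sub>0) within \<Omega>)"
proof -
  let ?N = "\<lambda>(\<omega>, c). sobolev_norm m (\<lambda>x. \<phi> b \<omega> c x - \<phi> b \<omega>\<^sub>0 c\<^sub>0 x)"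
  have g: "gam b > 0" using assms(1) by (simp add: gam_def)
  have c0: "c\<^sub>0 > 0" using assms by simp
  have gap0: "4 * \<omega>\<^sub>0 - c\<^sub>0\<^sup>2 = 0" using assms by (simp add: power_mult_distrib)
  \<comment> \<open>Near the limit point, \<open>U\<close> keeps \<open>c\<close> bounded and away
    from 0, and \<open>\<omega> < 2 * \<omega>\<^sub>0\<close> bounds the square of \<open>s\<close>
    by \<open>8 * \<omega>\<^sub>0\<close>.\<close>
  define U where "U = {..<2 * \<omega>\<^sub>0} \<times> {c\<^sub>0 / 2<..<2 * c\<^sub>0}"
  have "(?N \<longlongrightarrow> 0) (at (\<omega>\<^sub>0, c\<^sub>0) within \<Omega> \<inter> U)"
    unfolding tendsto_at_iff_sequentially
  proof (intro allI impI)
    fix X assume X: "\<forall>n. X n \<in> \<Omega> \<inter> U - {(\<omega>\<^sub>0, c\<^sub>0)}" "X \<longlonglongrightarrow> (\<omega>\<^sub>0, c\<^sub>0)"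
    define \<omega> c where "\<omega> n = fst (X n)" and "c n = snd (X n)" for n
    define s where "s n = sqrt (4 * \<omega> n - (c n)\<^sup>2)" for n
    have XO: "\<omega> n > 0" "c n < 2 * sqrt (\<omega> n)" "\<omega> n < 2 * \<omega>\<^sub>0" "c\<^sub>0 / 2 < c n" "c n < 2 * c\<^sub>0" for n
      using X(1)[rule_format, of n] by (auto simp: \<Omega>_def U_def \<omega>_def c_def)
    have lim: "\<omega> \<longlonglongrightarrow> \<omega>\<^sub>0" "c \<longlonglongrightarrow> c\<^sub>0"
      using tendsto_fst[OF X(2)] tendsto_snd[OF X(2)] by (simp_all add: \<omega>_def [abs_def] c_def [abs_def])
    have gap: "(c n)\<^sup>2 \<le> 4 * \<omega> n" for n
    proof -
      have "(c n)\<^sup>2 \<le> (2 * sqrt (\<omega> n))\<^sup>2"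
        using XO[of n] c0 by (intro power_mono) auto
      then show ?thesis using XO(1)[of n] by (simp add: power_mult_distrib)
    qed
    have "s \<longlonglongrightarrow> sqrt (4 * \<omega>\<^sub>0 - c\<^sub>0\<^sup>2)"
      unfolding s_def [abs_def] by (intro tendsto_intros lim)
    then have s_lim: "s \<longlonglongrightarrow> 0" by (simp add: gap0)
    have s_bound: "0 \<le> s n" "s n \<le> sqrt (8 * \<omega>\<^sub>0)" for n
    proof -
      show "0 \<le> s n" using gap[of n] by (simp add: s_def)
      have "4 * \<omega> n - (c n)\<^sup>2 \<le> 8 * \<omega>\<^sub>0"
        using XO(3)[of n] zero_le_power2[of "c n"] by linarith
      then show "s n \<le> sqrt (8 * \<omega>\<^sub>0)" unfolding s_def by (rule real_sqrt_le_mono)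
    qed
    have "(\<lambda>n. sobolev_norm m (\<lambda>x. prof (gam b) (c n) (s n) x - prof (gam b) c\<^sub>0 0 x)) \<longlonglongrightarrow> 0"
      using g c0 lim XO s_lim s_bound
      by (intro sobolev_norm_prof_diff_tendsto_0[where l = "c\<^sub>0 / 2" and u = "2 * c\<^sub>0" and S = "sqrt (8 * \<omega>\<^sub>0)"])
         (auto intro: less_imp_le simp: soliton_def)
    moreover have "\<phi> b (\<omega> n) (c n) = prof (gam b) (c n) (s n)" for n
      unfolding s_def using XO[of n] c0 by (intro \<phi>_eq_prof g) auto
    moreover have "\<phi> b \<omega>\<^sub>0 c\<^sub>0 = prof (gam b) c\<^sub>0 0"
      using \<phi>_eq_prof[OF g c0, of \<omega>\<^sub>0] assms(3) gap0 by simp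
    moreover have "(?N \<circ> X) n = sobolev_norm m (\<lambda>x. \<phi> b (\<omega> n) (c n) x - \<phi> b \<omega>\<^sub>0 c\<^sub>0 x)" for n
      by (simp add: \<omega>_def c_def case_prod_unfold)
    ultimately show "(?N \<circ> X) \<longlonglongrightarrow> 0"
      by (simp add: fun_eq_iff o_def)
  qed
  \<comment> \<open>\<open>U\<close> is an open neighbourhood of the limit point, so restricting to
    it does not change the limit.\<close>
  moreover have "at (\<omega>\<^sub>0, c\<^sub>0) within \<Omega> = at (\<omega>\<^sub>0, c\<^sub>0) within \<Omega> \<inter> U"
    using assms(2) c0 by (intro at_within_nhd[of _ U]) (auto simp: U_def intro!: open_Times)
  ultimately show ?thesis by simp
qed

end
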